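(* Let $M_j\subset\mathbb{C}^{n_j}$, $j=1,2$, be stratified totally real sets which admit Carleman approximation by entire functions. Then $M_1\times M_2\subset\mathbb{C}^{n_1}\times\mathbb{C}^{n_2}$ admits Carleman approximation by entire functions.
   Context: Carleman approximation: a closed set $M\subset\mathbb{C}^n$ admits Carleman approximation by entire functions if $\mathcal{O}(\mathbb{C}^n)$ is dense in $\mathcal{C}(M)$ (continuous complex-valued functions) in the Whitney $\mathcal{C}^0$-topology, i.e. for every $f\in\mathcal{C}(M)$ and every continuous $\epsilon:M\to(0,\infty)$ there is an entire function $g\in\mathcal{O}(\mathbb{C}^n)$ with $|g(x)-f(x)|<\epsilon(x)$ for all $x\in M$. Totally real set: a set $S\subset\mathbb{C}^n$ is a totally real set if it is locally contained in totally real submanifolds: each point of $S$ has an open neighborhood $U$ in $\mathbb{C}^n$ such that $S\cap U$ is contained in a $\mathcal{C}^1$-smooth totally real submanifold of $U$ (one whose tangent spaces contain no complex lines). Stratified totally real set: a closed set $M\subset\mathbb{C}^n$ is a stratified totally real set if it is an increasing union $M_0\subset M_1\subset\cdots\subset M_N=M$ of finitely many closed sets such that $M_0$ is a totally real set and $M_j\setminus M_{j-1}$ is a totally real set for $j=1,\dots,N$. *)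

theory Defs
  imports "HOL-Analysis.Analysis"
begin

text \<open>
  Complex Euclidean space is \<^typ>\<open>complex ^ 'n\<close>, regarded as a real Euclidean space for the
  differential-topological notions; multiplication by complex scalars is \<^term>\<open>(*s)\<close>.
\<close>

text \<open>Holomorphic on all of the space: the real Frechet derivative exists and is complex linear.\<close>

definition entire_fun :: "(complex ^ 'n \<Rightarrow> complex) \<Rightarrow> bool" where
  "entire_fun g \<longleftrightarrow>
    (\<forall>z. \<exists>g'. (g has_derivative g') (at z) \<and> (\<forall>c v. g' (c *s v) = c * g' v))"

definition admits_Carleman_approximation :: "(complex ^ 'n) set \<Rightarrow> bool" where
  "admits_Carleman_approximation M \<longleftrightarrow> closed M \<and>
    (\<forall>(f :: complex ^ 'n \<Rightarrow> complex) (\<epsilon> :: complex ^ 'n \<Rightarrow> real).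
      continuous_on M f \<longrightarrow> continuous_on M \<epsilon> \<longrightarrow> (\<forall>x\<in>M. \<epsilon> x > 0) \<longrightarrow>
      (\<exists>g. entire_fun g \<and> (\<forall>x\<in>M. cmod (g x - f x) < \<epsilon> x)))"

definition C1_map_on :: "'a::euclidean_space set \<Rightarrow> ('a \<Rightarrow> 'b::euclidean_space) \<Rightarrow> bool" where
  "C1_map_on V f \<longleftrightarrow>
    (\<exists>f' :: 'a \<Rightarrow> 'a \<Rightarrow>\<^sub>L 'b.
      (\<forall>x\<in>V. (f has_derivative blinfun_apply (f' x)) (at x)) \<and> continuous_on V f')"

definition C1_diffeomorphism :: "'a::euclidean_space set \<Rightarrow> 'a set \<Rightarrow> ('a \<Rightarrow> 'a) \<Rightarrow> bool" where
  "C1_diffeomorphism V W \<phi> \<longleftrightarrow>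
    open V \<and> open W \<and>
    (\<exists>\<psi>. homeomorphism V W \<phi> \<psi> \<and> C1_map_on V \<phi> \<and> C1_map_on W \<psi>)"

text \<open>
  Embedded submanifold of the open set \<open>U\<close>, of some constant real dimension \<open>d\<close>, given by
  straightening charts. It need not be relatively closed in \<open>U\<close>.
\<close>

definition C1_submanifold_of :: "'a::euclidean_space set \<Rightarrow> 'a set \<Rightarrow> bool" where
  "C1_submanifold_of U \<Sigma> \<longleftrightarrow> open U \<and> \<Sigma> \<subseteq> U \<and>
    (\<exists>d. \<forall>p\<in>\<Sigma>. \<exists>V W \<phi> L. p \<in> V \<and> V \<subseteq> U \<and> C1_diffeomorphism V W \<phi> \<and>
       subspace L \<and> dim L = d \<and> \<phi> ` (\<Sigma> \<inter> V) = W \<inter> L)"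

text \<open>Velocity vectors at \<open>p\<close> of continuously differentiable curves in \<open>\<Sigma>\<close>.\<close>

definition tangent_space_at :: "'a::euclidean_space set \<Rightarrow> 'a \<Rightarrow> 'a set" where
  "tangent_space_at \<Sigma> p =
    {v. \<exists>\<gamma> e. e > 0 \<and> \<gamma> C1_differentiable_on {-e<..<e} \<and> \<gamma> ` {-e<..<e} \<subseteq> \<Sigma> \<and>
        \<gamma> 0 = p \<and> (\<gamma> has_vector_derivative v) (at 0)}"

definition totally_real_submanifold_of :: "(complex ^ 'n) set \<Rightarrow> (complex ^ 'n) set \<Rightarrow> bool" where
  "totally_real_submanifold_of U \<Sigma> \<longleftrightarrow> C1_submanifold_of U \<Sigma> \<and>
    (\<forall>p\<in>\<Sigma>. \<not> (\<exists>v. v \<noteq> 0 \<and> range (\<lambda>c. c *s v) \<subseteq> tangent_space_at \<Sigma> p))"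

definition totally_real_set :: "(complex ^ 'n) set \<Rightarrow> bool" where
  "totally_real_set S \<longleftrightarrow>
    (\<forall>p\<in>S. \<exists>U \<Sigma>. open U \<and> p \<in> U \<and> totally_real_submanifold_of U \<Sigma> \<and> S \<inter> U \<subseteq> \<Sigma>)"

definition stratified_totally_real_set :: "(complex ^ 'n) set \<Rightarrow> bool" where
  "stratified_totally_real_set M \<longleftrightarrow> closed M \<and>
    (\<exists>(N::nat) A. A N = M \<and> (\<forall>j\<le>N. closed (A j)) \<and> (\<forall>j<N. A j \<subseteq> A (Suc j)) \<and>
      totally_real_set (A 0) \<and> (\<forall>j<N. totally_real_set (A (Suc j) - A j)))"

text \<open>
  The identification of a product of two complex Euclidean spaces with the one indexed by the
  disjoint union of the coordinates.
\<close>

definition vec_join :: "(complex ^ 'n) \<times> (complex ^ 'm) \<Rightarrow> complex ^ ('n + 'm)" where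
  "vec_join = (\<lambda>(x, y). \<chi> k. case k of Inl i \<Rightarrow> x $ i | Inr j \<Rightarrow> y $ j)"

end

theory Submission
  imports Defs "HOL-Complex_Analysis.Cauchy_Integral_Formula"
begin

text \<open>
  Carleman approximation is recast as a decoupling of compact sets from infinity, a property of
  approximation on compact sets only, which passes to products easily. Say that \<open>K\<close> is decoupled by \<open>L\<close> if every continuous
  function on \<open>M\<close> that vanishes on \<open>M \<inter> L\<close> can be approximated, uniformly on any compact part of
  \<open>M\<close>, by entire functions that are at the same time uniformly small on \<open>K\<close>. For closed \<open>M\<close>,
  Carleman approximation amounts to this: continuous functions are uniform limits of
  entire functions on the compact parts of \<open>M\<close>, and every compact \<open>K\<close> is decoupled by some
  compact \<open>L\<close>.

  Carleman approximation forces decoupling by a gliding hump (\<open>Carleman_imp_decouples\<close>). If no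
  \<open>L\<close> works for \<open>K\<close>, there are functions \<open>a\<^sub>j\<close>, vanishing on larger and larger balls, each of which
  resists approximation together with smallness on \<open>K\<close>. An entire \<open>g\<close> that is within
  \<open>1\<close> of the locally finite sum of the \<open>\<theta>\<^sub>j a\<^sub>j\<close> has some bound on \<open>K\<close>. If the
  coefficients \<open>\<theta>\<^sub>j\<close> grow fast enough, subtracting an approximant of the preceding partial sum from \<open>g\<close> and
  dividing by \<open>\<theta>\<^sub>j\<close> makes both the error and the bound on \<open>K\<close> small, which contradicts the choice
  of \<open>a\<^sub>j\<close> for large \<open>j\<close>.

  Conversely decoupling gives Carleman approximation by a Mittag-Leffler argument over an exhaustion
  by balls (\<open>decouples_imp_Carleman\<close>): the remaining error, cut off near the ball already treated, is
  corrected by an entire function that is small on a smaller ball, so the corrections converge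
  locally uniformly.

  Decoupling is inherited by products because it concerns finite sums only
  (\<open>decouples_product\<close>). A function vanishing on \<open>L\<^sub>1 \<times> L\<^sub>2\<close> is uniformly close, on a compact set, to a
  finite sum of products \<open>p(x) q(y)\<close> in which \<open>p\<close> vanishes on \<open>L\<^sub>1\<close> or \<open>q\<close> vanishes on \<open>L\<^sub>2\<close>. If \<open>p\<close> does,
  approximate \<open>q\<close> first, by some \<open>h\<close>, and then \<open>p\<close> by some \<open>g\<close> that is so small on \<open>K\<^sub>1\<close>
  that the bound of \<open>h\<close> on \<open>K\<^sub>2\<close> does not matter. The sets \<open>L\<^sub>1\<close> and \<open>L\<^sub>2\<close> depend on
  \<open>K\<^sub>1\<close> and \<open>K\<^sub>2\<close> alone, so the unknown size of \<open>h\<close> does no harm.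
\<close>

section \<open>Entire functions of several complex variables\<close>

lemma entire_fun_has_derivative_at:
  assumes "entire_fun g"
  shows "(g has_derivative frechet_derivative g (at z)) (at z)"
  using assms frechet_derivative_works unfolding entire_fun_def differentiable_def by blast

lemma entire_fun_derivative_complex_linear:
  assumes "entire_fun g"
  shows "frechet_derivative g (at z) (c *s v) = c * frechet_derivative g (at z) v"
  using assms frechet_derivative_at unfolding entire_fun_def by metis

lemma entire_fun_continuous_on: "entire_fun g \<Longrightarrow> continuous_on S g"
  by (meson continuous_at_imp_continuous_on entire_fun_has_derivative_at has_derivative_continuous)

lemma entire_fun_bounded_on_compact:
  assumes "entire_fun g" and "compact K"
  obtains B where "B \<ge> 0" and "\<And>z. z \<in> K \<Longrightarrow> cmod (g z) \<le> B"
proof -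
  have "bounded (g ` K)"
    using assms compact_continuous_image compact_imp_bounded entire_fun_continuous_on by blast
  then show thesis
    using that unfolding bounded_pos by (metis image_eqI less_imp_le)
qed

lemma entire_fun_const: "entire_fun (\<lambda>z. c)"
  unfolding entire_fun_def by (auto intro!: exI[of _ "\<lambda>h. 0"])

lemma entire_fun_add:
  assumes "entire_fun f" and "entire_fun g"
  shows "entire_fun (\<lambda>z. f z + g z)"
  unfolding entire_fun_def
proof
  fix z
  show "\<exists>D. ((\<lambda>z. f z + g z) has_derivative D) (at z) \<and> (\<forall>c v. D (c *s v) = c * D v)"
    using has_derivative_add[OF entire_fun_has_derivative_at[OF assms(1), of z]
        entire_fun_has_derivative_at[OF assms(2), of z]]
    by (intro exI conjI)
      (auto simp: assms entire_fun_derivative_complex_linear algebra_simps)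
qed

lemma entire_fun_mult:
  assumes "entire_fun f" and "entire_fun g"
  shows "entire_fun (\<lambda>z. f z * g z)"
  unfolding entire_fun_def
proof
  fix z
  show "\<exists>D. ((\<lambda>z. f z * g z) has_derivative D) (at z) \<and> (\<forall>c v. D (c *s v) = c * D v)"
    using has_derivative_mult[OF entire_fun_has_derivative_at[OF assms(1), of z]
        entire_fun_has_derivative_at[OF assms(2), of z]]
    by (intro exI conjI)
      (auto simp: assms entire_fun_derivative_complex_linear algebra_simps)
qed

lemma entire_fun_diff:
  assumes "entire_fun f" and "entire_fun g"
  shows "entire_fun (\<lambda>z. f z - g z)"
  using entire_fun_add[OF assms(1) entire_fun_mult[OF entire_fun_const[of "-1"] assms(2)]] by simp

lemma entire_fun_sum:
  assumes "\<And>i. i \<in> I \<Longrightarrow> entire_fun (f i)"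
  shows "entire_fun (\<lambda>z. \<Sum>i\<in>I. f i z)"
  using assms
  by (induction I rule: infinite_finite_induct) (auto intro: entire_fun_const entire_fun_add)

lemma entire_fun_compose_linear:
  fixes T :: "complex ^ 'm \<Rightarrow> complex ^ 'n"
  assumes "entire_fun g" and "linear T" and T: "\<And>c v. T (c *s v) = c *s T v"
  shows "entire_fun (\<lambda>z. g (T z))"
  unfolding entire_fun_def
proof
  fix z
  have "(T has_derivative T) (at z)"
    using assms(2) by (simp add: bounded_linear_imp_has_derivative linear_conv_bounded_linear)
  from has_derivative_compose[OF this entire_fun_has_derivative_at[OF assms(1)]]
  show "\<exists>D. ((\<lambda>z. g (T z)) has_derivative D) (at z) \<and> (\<forall>c v. D (c *s v) = c * D v)"
    by (intro exI conjI) (auto simp: assms T entire_fun_derivative_complex_linear)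
qed

lemma norm_scalar_mult_vec: "norm (c *s v) = cmod c * norm (v :: complex ^ 'n)"
  by (simp add: norm_vec_def vector_scalar_mult_def norm_mult L2_set_right_distrib)

lemma linear_scalar_mult_vec: "linear (\<lambda>c. c *s (v :: complex ^ 'n))"
  by (rule linearI) (auto simp: vec_eq_iff algebra_simps)

text \<open>
  Restricted to a complex line the function is holomorphic in one variable, so this is the
  one-variable Cauchy inequality on that line.
\<close>

lemma entire_fun_Cauchy_estimate:
  fixes g :: "complex ^ 'n \<Rightarrow> complex"
  assumes g: "entire_fun g" and B: "\<And>w. w \<in> cball z 1 \<Longrightarrow> cmod (g w) \<le> B"
  shows "cmod (frechet_derivative g (at z) h) \<le> B * norm h"
proof (cases "h = 0")
  case True
  then show ?thesis
    using entire_fun_derivative_complex_linear[OF g, of z 0 0] by simp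
next
  case False
  define \<phi> where "\<phi> = (\<lambda>t. g (z + t *s h))"
  have d: "(\<phi> has_field_derivative frechet_derivative g (at (z + t *s h)) h) (at t)" for t
  proof -
    have "((\<lambda>t. t *s h) has_derivative (\<lambda>t. t *s h)) (at t)"
      using linear_scalar_mult_vec linear_conv_bounded_linear bounded_linear_imp_has_derivative
      by blast
    then have "((\<lambda>t. z + t *s h) has_derivative (\<lambda>t. t *s h)) (at t)"
      by (auto intro!: derivative_eq_intros)
    from has_derivative_compose[OF this entire_fun_has_derivative_at[OF g]]
    show ?thesis
      unfolding \<phi>_def has_field_derivative_def
      by (simp add: entire_fun_derivative_complex_linear[OF g] mult_commute_abs)
  qed
  have hol: "\<phi> holomorphic_on S" for S
    using d by (meson field_differentiable_at_within field_differentiable_def holomorphic_onI)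
  have "cmod ((deriv ^^ 1) \<phi> 0) \<le> fact 1 * B / (1 / norm h) ^ 1"
  proof (rule Cauchy_inequality[OF hol holomorphic_on_imp_continuous_on[OF hol]])
    fix t :: complex
    assume "cmod (0 - t) = 1 / norm h"
    with False have "z + t *s h \<in> cball z 1"
      by (simp add: dist_norm norm_scalar_mult_vec)
    then show "cmod (\<phi> t) \<le> B"
      unfolding \<phi>_def by (rule B)
  qed (use False in simp)
  then show ?thesis
    using DERIV_imp_deriv[OF d, of 0] by simp
qed

text \<open>
  By the Cauchy estimate uniform convergence on balls carries over to the derivatives, and
  complex linearity of the derivatives survives in the limit.
\<close>

lemma entire_fun_uniform_limit:
  fixes f :: "nat \<Rightarrow> complex ^ 'n \<Rightarrow> complex"
  assumes f: "\<And>n. entire_fun (f n)"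
    and lim: "\<And>R. uniform_limit (cball 0 R) f g sequentially"
  shows "entire_fun g"
proof -
  define D where "D n z = frechet_derivative (f n) (at z)" for n z
  have cauchy: "\<exists>N. \<forall>n\<ge>N. \<forall>m\<ge>N. \<forall>z\<in>cball 0 R. \<forall>h. cmod (D n z h - D m z h) \<le> e * norm h"
    if "e > 0" for e R
  proof -
    obtain N where N: "cmod (f n w - g w) < e / 2" if "n \<ge> N" "w \<in> cball 0 (R + 1)" for n w
      using lim[of "R + 1"] \<open>e > 0\<close> unfolding uniform_limit_iff eventually_sequentially dist_norm
      by (meson half_gt_zero)
    show ?thesis
    proof (intro exI allI impI ballI)
      fix n m and z h :: "complex ^ 'n"
      assume "n \<ge> N" "m \<ge> N" "z \<in> cball 0 R"
      have "frechet_derivative (\<lambda>w. f n w - f m w) (at z) = (\<lambda>h. D n z h - D m z h)"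
        unfolding D_def
        using frechet_derivative_at[OF has_derivative_diff[OF entire_fun_has_derivative_at[OF f, of n z]
            entire_fun_has_derivative_at[OF f, of m z]]] by simp
      moreover have "cmod (f n w - f m w) \<le> e" if "w \<in> cball z 1" for w
      proof -
        have "norm w \<le> norm z + dist z w"
          by (metis dist_0_norm dist_triangle)
        then have "w \<in> cball 0 (R + 1)"
          using that \<open>z \<in> cball 0 R\<close> by simp
        then show ?thesis
          using N[OF \<open>n \<ge> N\<close>, of w] N[OF \<open>m \<ge> N\<close>, of w]
            norm_triangle_ineq4[of "f n w - g w" "f m w - g w"] by simp
      qed
      ultimately show "cmod (D n z h - D m z h) \<le> e * norm h"
        using entire_fun_Cauchy_estimate[OF entire_fun_diff[OF f f], of z n m e h] by simp
    qed
  qed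
  have "convergent (\<lambda>n. D n z h)" for z h
  proof (rule Cauchy_convergent, unfold Cauchy_iff, intro allI impI)
    fix e :: real
    assume "e > 0"
    define e' where "e' = e / (norm h + 1)"
    have e': "e' > 0" "e' * norm h < e"
      using \<open>e > 0\<close> add_nonneg_pos[OF norm_ge_zero zero_less_one, of h]
      unfolding e'_def by (auto simp: field_simps)
    from cauchy[OF e'(1), of "norm z"] e'(2)
    show "\<exists>M. \<forall>m\<ge>M. \<forall>n\<ge>M. norm (D m z h - D n z h) < e"
      by (meson mem_cball_0 order_refl order_le_less_trans)
  qed
  then obtain D' where D': "(\<lambda>n. D n z h) \<longlonglongrightarrow> D' z h" for z h
    unfolding convergent_def by metis
  have unif: "\<forall>\<^sub>F n in sequentially. \<forall>z\<in>cball 0 R. \<forall>h. norm (D n z h - D' z h) \<le> e * norm h"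
    if "e > 0" for e R
  proof -
    obtain N where N: "cmod (D n z h - D m z h) \<le> e * norm h"
      if "n \<ge> N" "m \<ge> N" "z \<in> cball 0 R" for n m z h
      using cauchy[OF \<open>e > 0\<close>] by blast
    have "norm (D n z h - D' z h) \<le> e * norm h" if "n \<ge> N" "z \<in> cball 0 R" for n z h
    proof (rule tendsto_upperbound)
      show "(\<lambda>m. norm (D n z h - D m z h)) \<longlonglongrightarrow> norm (D n z h - D' z h)"
        by (intro tendsto_intros D')
      show "\<forall>\<^sub>F m in sequentially. norm (D n z h - D m z h) \<le> e * norm h"
        using N that unfolding eventually_sequentially by blast
    qed simp
    then show ?thesis
      unfolding eventually_sequentially by blast
  qed
  show ?thesis
    unfolding entire_fun_def
  proof
    fix z :: "complex ^ 'n"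
    define R where "R = norm z + 1"
    have pt: "(\<lambda>n. f n w) \<longlonglongrightarrow> g w" for w
      using tendsto_uniform_limitI[OF lim, of w "norm w"] by simp
    have "\<exists>g1. \<forall>x\<in>cball 0 R. (\<lambda>n. f n x) \<longlonglongrightarrow> g1 x \<and>
        (g1 has_derivative D' x) (at x within cball 0 R)"
    proof (rule has_derivative_sequence)
      show "(f n has_derivative D n x) (at x within cball 0 R)" for n x
        unfolding D_def by (rule has_derivative_at_withinI[OF entire_fun_has_derivative_at[OF f]])
      show "z \<in> cball 0 R"
        unfolding R_def by simp
    qed (use unif pt in auto)
    then obtain g1 where g1: "(\<lambda>n. f n x) \<longlonglongrightarrow> g1 x"
      "(g1 has_derivative D' x) (at x within cball 0 R)" if "x \<in> cball 0 R" for x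
      by blast
    have eq: "g1 x = g x" if "x \<in> cball 0 R" for x
      using g1(1)[OF that] pt LIMSEQ_unique by blast
    have int: "z \<in> interior (cball 0 R)"
      unfolding R_def by simp
    have zR: "z \<in> cball 0 R"
      using int interior_subset by blast
    have "(g has_derivative D' z) (at z within cball 0 R)"
      by (rule has_derivative_transform[OF zR _ g1(2)[OF zR]]) (simp add: eq)
    then have "(g has_derivative D' z) (at z)"
      using at_within_interior[OF int] by simp
    moreover have "D' z (c *s v) = c * D' z v" for c v
    proof (rule LIMSEQ_unique[OF D'])
      show "(\<lambda>n. D n z (c *s v)) \<longlonglongrightarrow> c * D' z v"
        unfolding D_def entire_fun_derivative_complex_linear[OF f]
        using tendsto_mult_left[OF D'[of z v], of c] unfolding D_def .
    qed
    ultimately show "\<exists>g'. (g has_derivative g') (at z) \<and> (\<forall>c v. g' (c *s v) = c * g' v)"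
      by blast
  qed
qed

section \<open>Decoupling compact sets from infinity\<close>

text \<open>
  The order of quantifiers is the point: \<open>L\<close> is fixed before the function, the compact part \<open>X\<close> and
  the tolerance. With \<open>K = L = {}\<close> this is uniform approximation on compact parts of \<open>M\<close>.
\<close>

definition decouples :: "(complex ^ 'n) set \<Rightarrow> (complex ^ 'n) set \<Rightarrow> (complex ^ 'n) set \<Rightarrow> bool" where
  "decouples M K L \<longleftrightarrow>
    (\<forall>a X \<delta>. continuous_on M a \<longrightarrow> (\<forall>x\<in>M \<inter> L. a x = 0) \<longrightarrow> compact X \<longrightarrow> X \<subseteq> M \<longrightarrow> 0 < \<delta> \<longrightarrow>
      (\<exists>g. entire_fun g \<and> (\<forall>x\<in>X. cmod (g x - a x) < \<delta>) \<and> (\<forall>z\<in>K. cmod (g z) < \<delta>)))"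

lemma decouplesE:
  assumes "decouples M K L" and "continuous_on M a" and "\<And>x. x \<in> M \<Longrightarrow> x \<in> L \<Longrightarrow> a x = 0"
    and "compact X" and "X \<subseteq> M" and "0 < \<delta>"
  obtains g where "entire_fun g" and "\<And>x. x \<in> X \<Longrightarrow> cmod (g x - a x) < \<delta>"
    and "\<And>z. z \<in> K \<Longrightarrow> cmod (g z) < \<delta>"
proof -
  have "\<forall>x\<in>M \<inter> L. a x = 0"
    using assms(3) by blast
  with assms(1)[unfolded decouples_def, rule_format, OF assms(2) _ assms(4-6)] show thesis
    using that by blast
qed

lemma decouples_mono:
  assumes "decouples M K L" and "K' \<subseteq> K" and "L \<subseteq> L'"
  shows "decouples M K' L'"
  unfolding decouples_def
proof (intro allI impI)
  fix a :: "complex ^ 'a \<Rightarrow> complex" and X and \<delta> :: real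
  assume a: "continuous_on M a" "\<forall>x\<in>M \<inter> L'. a x = 0" and X: "compact X" "X \<subseteq> M" "0 < \<delta>"
  have "a x = 0" if "x \<in> M" "x \<in> L" for x
    using a(2) assms(3) that by blast
  from decouplesE[OF assms(1) a(1) this X] obtain g where "entire_fun g"
    "\<And>x. x \<in> X \<Longrightarrow> cmod (g x - a x) < \<delta>" "\<And>z. z \<in> K \<Longrightarrow> cmod (g z) < \<delta>"
    by blast
  with assms(2) show "\<exists>g. entire_fun g \<and> (\<forall>x\<in>X. cmod (g x - a x) < \<delta>) \<and> (\<forall>z\<in>K'. cmod (g z) < \<delta>)"
    by blast
qed

lemma Carleman_uniform_approximation:
  assumes "admits_Carleman_approximation M" and f: "continuous_on M f" and \<delta>: "0 < \<delta>"
  obtains g where "entire_fun g" and "\<And>x. x \<in> M \<Longrightarrow> cmod (g x - f x) < \<delta>"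
proof -
  have "\<forall>x\<in>M. 0 < \<delta>"
    using \<delta> by simp
  with assms(1) f continuous_on_const[of M \<delta>]
  have "\<exists>g. entire_fun g \<and> (\<forall>x\<in>M. cmod (g x - f x) < \<delta>)"
    unfolding admits_Carleman_approximation_def
    by (elim conjE allE[of _ f] allE[of _ "\<lambda>_. \<delta>"]) simp
  then show thesis
    using that by blast
qed

section \<open>Carleman approximation decouples compact sets from infinity\<close>

lemma Carleman_imp_decouples_empty:
  assumes "admits_Carleman_approximation M"
  shows "decouples M {} {}"
  unfolding decouples_def
proof (intro allI impI)
  fix a :: "complex ^ 'a \<Rightarrow> complex" and X and \<delta> :: real
  assume "continuous_on M a" and X: "X \<subseteq> M" and "0 < \<delta>"
  then obtain g where "entire_fun g" "\<And>x. x \<in> M \<Longrightarrow> cmod (g x - a x) < \<delta>"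
    using Carleman_uniform_approximation[OF assms] by blast
  then show "\<exists>g. entire_fun g \<and> (\<forall>x\<in>X. cmod (g x - a x) < \<delta>) \<and> (\<forall>z\<in>{}. cmod (g z) < \<delta>)"
    using X by blast
qed

text \<open>
  A gliding hump. Functions \<open>a\<^sub>j\<close> violating the claim for balls whose radii \<open>S j\<close> tend to infinity are
  added up with rapidly growing coefficients. The radii increase so fast that on the compact set where
  \<open>a\<^sub>j\<close> fails the later summands vanish; the sum there is the previous partial sum plus \<open>\<theta>\<^sub>j a\<^sub>j\<close>.
\<close>

lemma Carleman_imp_decouples:
  fixes M :: "(complex ^ 'n) set"
  assumes M: "admits_Carleman_approximation M" and K: "compact K"
  shows "\<exists>R. decouples M K (cball 0 R)"
proof (rule ccontr)
  assume "\<nexists>R. decouples M K (cball 0 R)"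
  define fails where "fails R a X \<delta> \<longleftrightarrow> continuous_on M a \<and> (\<forall>x\<in>M \<inter> cball 0 R. a x = 0) \<and>
      compact X \<and> X \<subseteq> M \<and> 0 < \<delta> \<and>
      \<not> (\<exists>g. entire_fun g \<and> (\<forall>x\<in>X. cmod (g x - a x) < \<delta>) \<and> (\<forall>z\<in>K. cmod (g z) < \<delta>))"
    for R :: real and a X and \<delta> :: real
  have "\<exists>a X \<delta>. fails R a X \<delta>" for R
  proof -
    have "\<not> decouples M K (cball 0 R)"
      using \<open>\<nexists>R. decouples M K (cball 0 R)\<close> by blast
    then show ?thesis
      unfolding decouples_def fails_def by (simp only: not_all not_imp)
  qed
  then obtain a X \<delta> where fails: "\<And>R. fails R (a R) (X R) (\<delta> R)"
    by metis
  have a: "\<And>R. continuous_on M (a R)"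
    and a0: "\<And>R x. x \<in> M \<Longrightarrow> norm x \<le> R \<Longrightarrow> a R x = 0"
    and X: "\<And>R. compact (X R)" "\<And>R. X R \<subseteq> M" and \<delta>: "\<And>R. 0 < \<delta> R"
    and bad: "\<And>R. \<not> (\<exists>g. entire_fun g \<and> (\<forall>x\<in>X R. cmod (g x - a R x) < \<delta> R) \<and> (\<forall>z\<in>K. cmod (g z) < \<delta> R))"
    using fails unfolding fails_def by (simp_all del: not_ex)
  have "\<exists>\<rho>. \<forall>x\<in>X R. norm x \<le> \<rho>" for R :: real
    using compact_imp_bounded[OF X(1)] unfolding bounded_iff .
  then obtain \<rho> where \<rho>: "\<And>R x. x \<in> X R \<Longrightarrow> norm x \<le> \<rho> R"
    by metis
  define S where "S = rec_nat 0 (\<lambda>_ s. max (s + 1) (\<rho> s))"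
  have S_Suc: "S (Suc j) = max (S j + 1) (\<rho> (S j))" and S_0: "S 0 = 0" for j
    unfolding S_def by simp_all
  have S_ge: "real j \<le> S j" for j
    by (induction j) (auto simp: S_0 S_Suc)
  have S_mono: "S i \<le> S j" if "i \<le> j" for i j
    by (rule lift_Suc_mono_le[of S, OF _ that]) (simp add: S_Suc)

  have approx: "\<exists>k\<ge>0. \<exists>g. entire_fun g \<and> (\<forall>x\<in>M. cmod (g x - u x) < 1) \<and> (\<forall>z\<in>K. cmod (g z) \<le> k)"
    if u: "continuous_on M u" for u
  proof -
    obtain g where g: "entire_fun g" "\<And>x. x \<in> M \<Longrightarrow> cmod (g x - u x) < 1"
      using Carleman_uniform_approximation[OF M u zero_less_one] by blast
    obtain B where "0 \<le> B" "\<And>z. z \<in> K \<Longrightarrow> cmod (g z) \<le> B"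
      using entire_fun_bounded_on_compact[OF g(1) K] by blast
    with g show ?thesis
      by blast
  qed
  (* k u bounds on K one approximant of u within 1; theta j has to dominate it for the j-th partial
     sum, together with the bound C of the final approximant, which is below j for large j. *)
  define k where "k u = (SOME k. k \<ge> 0 \<and>
      (\<exists>g. entire_fun g \<and> (\<forall>x\<in>M. cmod (g x - u x) < 1) \<and> (\<forall>z\<in>K. cmod (g z) \<le> k)))" for u
  have k: "0 \<le> k u \<and>
      (\<exists>g. entire_fun g \<and> (\<forall>x\<in>M. cmod (g x - u x) < 1) \<and> (\<forall>z\<in>K. cmod (g z) \<le> k u))"
    if "continuous_on M u" for u
    unfolding k_def by (rule someI_ex[OF approx[OF that]])

  define \<theta> where "\<theta> j u = (2 + real j + k u) / \<delta> (S j)" for j u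
  define u where "u = rec_nat (\<lambda>_. 0) (\<lambda>j v x. v x + of_real (\<theta> j v) * a (S j) x)"
  have u_Suc: "u (Suc j) = (\<lambda>x. u j x + of_real (\<theta> j (u j)) * a (S j) x)" and u_0: "u 0 = (\<lambda>_. 0)" for j
    unfolding u_def by simp_all
  have u: "continuous_on M (u j)" for j
    by (induction j) (auto simp: u_0 u_Suc intro!: continuous_intros a)
  have u_stable: "u i x = u j x" if "x \<in> M" "norm x \<le> S j" "j \<le> i" for i j x
    using that(3)
  proof (induction i rule: dec_induct)
    case (step i)
    have "norm x \<le> S i"
      using that(2) S_mono[OF step(1)] by linarith
    then show ?case
      using step a0[OF that(1)] by (simp add: u_Suc)
  qed simp
  (* The limit of the partial sums; they are stationary at x from the index ceiling (norm x) on. *)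
  define f where "f x = u (nat \<lceil>norm x\<rceil>) x" for x
  have f_eq: "f x = u j x" if "x \<in> M" "norm x \<le> S j" for x j
  proof -
    have "norm x \<le> S (nat \<lceil>norm x\<rceil>)"
      using S_ge[of "nat \<lceil>norm x\<rceil>"] by linarith
    then show ?thesis
      unfolding f_def using u_stable[OF that(1)] that(2) by (metis nat_le_linear)
  qed
  have "continuous_on M f"
    unfolding continuous_on_eq_continuous_within
  proof
    fix x
    assume x: "x \<in> M"
    define j where "j = Suc (nat \<lceil>norm x\<rceil>)"
    have j: "norm x < S j"
      using S_ge[of j] unfolding j_def by linarith
    show "continuous (at x within M) f"
    proof (rule continuous_transform_within[of _ _ "u j"])
      show "continuous (at x within M) (u j)"
        using u x continuous_on_eq_continuous_within by blast
      show "0 < S j - norm x"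
        using j by simp
      fix y
      assume y: "y \<in> M" "dist y x < S j - norm x"
      have "norm y \<le> norm x + dist y x"
        by (metis add.commute dist_norm norm_triangle_sub)
      with y show "u j y = f y"
        using f_eq[of y j] by simp
    qed (rule x)
  qed
  from approx[OF this] obtain C g where "0 \<le> C" and g: "entire_fun g" "\<And>x. x \<in> M \<Longrightarrow> cmod (g x - f x) < 1"
    "\<And>z. z \<in> K \<Longrightarrow> cmod (g z) \<le> C"
    by blast
  obtain j where j: "C \<le> real j"
    using real_arch_simple by blast
  obtain h where h: "entire_fun h" "\<And>x. x \<in> M \<Longrightarrow> cmod (h x - u j x) < 1"
    "\<And>z. z \<in> K \<Longrightarrow> cmod (h z) \<le> k (u j)" and k0: "0 \<le> k (u j)"
    using k[OF u[of j]] by blast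
  define t where "t = \<theta> j (u j)"
  have t\<delta>: "t * \<delta> (S j) = 2 + real j + k (u j)"
    unfolding t_def \<theta>_def using \<delta>[of "S j"] by simp
  then have "0 < t * \<delta> (S j)"
    using k0 by linarith
  then have t: "0 < t"
    using \<delta>[of "S j"] by (simp add: zero_less_mult_iff)
  have small: "cmod (w / of_real t) < \<delta> (S j)" if "cmod w < 2 + real j + k (u j)" for w
    using that t unfolding t\<delta>[symmetric] by (simp add: norm_divide divide_less_eq mult.commute)
  (* g and h approximate partial sums that differ by t * a (S j) on X (S j). *)
  define G where "G z = (1 / of_real t) * (g z - h z)" for z
  have "entire_fun G"
    unfolding G_def by (intro entire_fun_mult entire_fun_const entire_fun_diff g h)
  moreover have "cmod (G x - a (S j) x) < \<delta> (S j)" if "x \<in> X (S j)" for x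
  proof -
    have xM: "x \<in> M"
      using X(2) that by blast
    have "norm x \<le> S (Suc j)"
      using \<rho>[OF that] by (simp add: S_Suc)
    from f_eq[OF xM this] have "G x - a (S j) x = ((g x - f x) - (h x - u j x)) / of_real t"
      unfolding G_def using t by (simp add: u_Suc t_def[symmetric] field_simps)
    moreover have "cmod ((g x - f x) - (h x - u j x)) < 2 + real j + k (u j)"
      using g(2)[OF xM] h(2)[OF xM] k0 norm_triangle_ineq4[of "g x - f x" "h x - u j x"] by linarith
    ultimately show ?thesis
      using small by metis
  qed
  moreover have "cmod (G z) < \<delta> (S j)" if "z \<in> K" for z
  proof -
    have "cmod (g z - h z) < 2 + real j + k (u j)"
      using g(3)[OF that] h(3)[OF that] j norm_triangle_ineq4[of "g z" "h z"] by linarith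
    from small[OF this] show ?thesis
      unfolding G_def by simp
  qed
  ultimately show False
    using bad by blast
qed

section \<open>Decoupling implies Carleman approximation\<close>

text \<open>
  The approximant is \<open>g 0 + (g 1 - g 0) + (g 2 - g 1) + \<dots>\<close>. The function \<open>g k\<close> is good on \<open>M\<close> in the ball
  of radius \<open>r (k + 2)\<close>, and the next correction is small on the ball of radius \<open>r k\<close>. The ball between
  them decouples the inner one, and the shell outside it leaves room for a cutoff function.
\<close>

lemma decouples_imp_Carleman:
  fixes M :: "(complex ^ 'n) set"
  assumes M: "closed M" and dec: "\<And>R. \<exists>S. decouples M (cball 0 R) (cball 0 S)"
    and dec0: "decouples M {} {}"
  shows "admits_Carleman_approximation M"
  unfolding admits_Carleman_approximation_def
proof (intro conjI allI impI)
  fix f :: "complex ^ 'n \<Rightarrow> complex" and \<epsilon> :: "complex ^ 'n \<Rightarrow> real"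
  assume f: "continuous_on M f" and \<epsilon>: "continuous_on M \<epsilon>" and pos: "\<forall>x\<in>M. 0 < \<epsilon> x"
  obtain S where S: "\<And>R. decouples M (cball 0 R) (cball 0 (S R))"
    using dec by metis
  define r where "r = rec_nat 0 (\<lambda>_ s. max (s + 1) (S s))"
  have r_0: "r 0 = 0" and r_Suc: "r (Suc k) = max (r k + 1) (S (r k))" for k
    unfolding r_def by simp_all
  have r_ge: "real k \<le> r k" for k
    by (induction k) (auto simp: r_0 r_Suc)
  have r_less: "r k < r (Suc k)" for k
    by (simp add: r_Suc)
  have dec_r: "decouples M (cball 0 (r k)) (cball 0 (r (Suc k)))" for k
    by (rule decouples_mono[OF S[of "r k"]]) (auto simp: r_Suc)
  have compact_r: "compact (M \<inter> cball 0 \<rho>)" for \<rho>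
    by (rule closed_Int_compact[OF M compact_cball])
  have min_\<epsilon>: "\<exists>m>0. \<forall>x\<in>M \<inter> cball 0 \<rho>. m \<le> \<epsilon> x" for \<rho>
  proof (cases "M \<inter> cball 0 \<rho> = {}")
    case False
    with continuous_attains_inf[OF compact_r False, of \<epsilon>] continuous_on_subset[OF \<epsilon>]
    obtain x0 where "x0 \<in> M \<inter> cball 0 \<rho>" "\<forall>x\<in>M \<inter> cball 0 \<rho>. \<epsilon> x0 \<le> \<epsilon> x"
      by blast
    then show ?thesis
      using pos by blast
  qed (auto intro: exI[of _ 1])

  (* The tolerance stays below half of epsilon, so that the limit satisfies the strict bound. *)
  define P where "P k g \<longleftrightarrow> entire_fun g \<and>
    (\<forall>x\<in>M \<inter> cball 0 (r (Suc (Suc k))). cmod (g x - f x) < \<epsilon> x / 2 * (1 - (1/2) ^ Suc k))"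
    for k :: nat and g
  define Q where "Q k g g' \<longleftrightarrow> (\<forall>z\<in>cball 0 (r k). cmod (g' z - g z) < (1/2) ^ k)"
    for k :: nat and g g' :: "complex ^ 'n \<Rightarrow> complex"
  have "\<exists>g. P 0 g"
  proof -
    obtain m where m: "0 < m" "\<forall>x\<in>M \<inter> cball 0 (r 2). m \<le> \<epsilon> x"
      using min_\<epsilon> by blast
    then have "0 < m / 4"
      by simp
    from decouplesE[OF dec0 f _ compact_r _ this] obtain g where g: "entire_fun g"
      "\<And>x. x \<in> M \<inter> cball 0 (r 2) \<Longrightarrow> cmod (g x - f x) < m / 4"
      by blast
    have "cmod (g x - f x) < \<epsilon> x / 2 * (1 - (1/2) ^ Suc 0)" if "x \<in> M \<inter> cball 0 (r 2)" for x
      using g(2)[OF that] m(2) that by force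
    with g(1) have "P 0 g"
      unfolding P_def numeral_2_eq_2 by blast
    then show ?thesis
      by blast
  qed
  moreover have "\<exists>g'. P (Suc k) g' \<and> Q k g g'" if P: "P k g" for k g
  proof -
    define s where "s = r (Suc k)"
    define s' where "s' = r (Suc (Suc k))"
    define s'' where "s'' = r (Suc (Suc (Suc k)))"
    have ss': "s < s'"
      unfolding s_def s'_def by (rule r_less)
    have g: "entire_fun g" and gf: "\<And>x. x \<in> M \<Longrightarrow> norm x \<le> s' \<Longrightarrow>
        cmod (g x - f x) < \<epsilon> x / 2 * (1 - (1/2) ^ Suc k)"
      using P unfolding P_def s'_def by auto
    define \<kappa> where "\<kappa> x = min 1 (max 0 ((norm x - s) / (s' - s)))" for x :: "complex ^ 'n"
    have \<kappa>0: "\<kappa> x = 0" if "norm x \<le> s" for x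
      using that ss' unfolding \<kappa>_def by (simp add: divide_nonpos_pos max_absorb1)
    have \<kappa>1: "\<kappa> x = 1" if "s' \<le> norm x" for x
      using that ss' unfolding \<kappa>_def by (simp add: le_divide_eq min_absorb1 max_absorb2)
    have \<kappa>01: "0 \<le> \<kappa> x" "\<kappa> x \<le> 1" for x
      unfolding \<kappa>_def by auto
    define a where "a x = of_real (\<kappa> x) * (f x - g x)" for x
    have "continuous_on M \<kappa>"
      unfolding \<kappa>_def using ss' by (intro continuous_intros) auto
    then have a: "continuous_on M a"
      unfolding a_def by (intro continuous_intros f entire_fun_continuous_on[OF g]) auto
    obtain m where m: "0 < m" "\<forall>x\<in>M \<inter> cball 0 s''. m \<le> \<epsilon> x"
      using min_\<epsilon> by blast
    define \<delta> where "\<delta> = min ((1/2) ^ k) (m / 2 * (1/2) ^ Suc (Suc k))"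
    have "0 < \<delta>"
      unfolding \<delta>_def using m(1) by simp
    have \<delta>m: "\<delta> \<le> \<epsilon> x / 2 * (1/2) ^ Suc (Suc k)" if "x \<in> M" "norm x \<le> s''" for x
    proof -
      have "m \<le> \<epsilon> x"
        using m(2) that by simp
      then have "m / 2 * (1/2) ^ Suc (Suc k) \<le> \<epsilon> x / 2 * (1/2) ^ Suc (Suc k)"
        by (intro mult_right_mono) auto
      then show ?thesis
        unfolding \<delta>_def by linarith
    qed
    obtain G where G: "entire_fun G" "\<And>x. x \<in> M \<inter> cball 0 s'' \<Longrightarrow> cmod (G x - a x) < \<delta>"
      "\<And>z. z \<in> cball 0 (r k) \<Longrightarrow> cmod (G z) < \<delta>"
    proof (rule decouplesE[OF dec_r[of k] a _ compact_r[of s''] _ \<open>0 < \<delta>\<close>])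
      show "a x = 0" if "x \<in> cball 0 (r (Suc k))" for x
        using that \<kappa>0[of x] unfolding a_def s_def by simp
    qed auto
    have "P (Suc k) (\<lambda>z. g z + G z)"
      unfolding P_def
    proof (intro conjI ballI)
      show "entire_fun (\<lambda>z. g z + G z)"
        by (rule entire_fun_add[OF g G(1)])
      fix x
      assume "x \<in> M \<inter> cball 0 (r (Suc (Suc (Suc k))))"
      then have x: "x \<in> M" "norm x \<le> s''"
        unfolding s''_def by auto
      have Gx: "cmod (G x - a x) < \<epsilon> x / 2 * (1/2) ^ Suc (Suc k)"
        using G(2)[of x] \<delta>m[OF x] x by auto
      (* A convex mixture: the old error survives only where the cutoff is below 1. *)
      have error_split: "g x + G x - f x = (G x - a x) + of_real (1 - \<kappa> x) * (g x - f x)"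
        unfolding a_def by (simp add: algebra_simps)
      have "cmod (of_real (1 - \<kappa> x) * (g x - f x)) \<le> \<epsilon> x / 2 * (1 - (1/2) ^ Suc k)"
      proof (cases "norm x \<le> s'")
        case True
        have "cmod (of_real (1 - \<kappa> x) * (g x - f x)) = (1 - \<kappa> x) * cmod (g x - f x)"
          using \<kappa>01[of x] by (simp add: norm_mult del: of_real_diff)
        also have "\<dots> \<le> 1 * cmod (g x - f x)"
          using \<kappa>01[of x] by (intro mult_right_mono) auto
        finally show ?thesis
          using gf[OF x(1) True] by linarith
      next
        case False
        have "0 \<le> 1 - (1/2 :: real) ^ Suc k"
          using power_le_one[of "1/2 :: real" "Suc k"] by simp
        with False show ?thesis
          using \<kappa>1[of x] pos x(1) by (simp add: less_imp_le)
      qed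
      moreover have "\<epsilon> x / 2 * (1 - (1/2) ^ Suc (Suc k)) =
          \<epsilon> x / 2 * (1 - (1/2) ^ Suc k) + \<epsilon> x / 2 * (1/2) ^ Suc (Suc k)"
        by (simp add: field_simps)
      ultimately show "cmod (g x + G x - f x) < \<epsilon> x / 2 * (1 - (1/2) ^ Suc (Suc k))"
        unfolding error_split using Gx norm_triangle_ineq[of "G x - a x" "of_real (1 - \<kappa> x) * (g x - f x)"]
        by linarith
    qed
    moreover have "Q k g (\<lambda>z. g z + G z)"
      unfolding Q_def using G(3) unfolding \<delta>_def by auto
    ultimately show ?thesis
      by blast
  qed
  ultimately obtain g where g: "\<And>k. P k (g k)" "\<And>k. Q k (g k) (g (Suc k))"
    using dependent_nat_choice[of P Q] by metis
  define h where "h z = g 0 z + (\<Sum>k. g (Suc k) z - g k z)" for z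
  have lim: "uniform_limit (cball 0 R) g h sequentially" for R
  proof -
    have "\<forall>\<^sub>F k in sequentially. \<forall>z\<in>cball 0 R. norm (g (Suc k) z - g k z) \<le> (1/2) ^ k"
    proof (rule eventually_sequentiallyI)
      fix k
      assume "nat \<lceil>R\<rceil> \<le> k"
      then have "R \<le> r k"
        using r_ge[of k] by linarith
      then show "\<forall>z\<in>cball 0 R. norm (g (Suc k) z - g k z) \<le> (1/2) ^ k"
        using g(2)[of k] unfolding Q_def by (auto intro!: less_imp_le)
    qed
    then have "uniform_limit (cball 0 R) (\<lambda>n z. \<Sum>k<n. g (Suc k) z - g k z)
        (\<lambda>z. \<Sum>k. g (Suc k) z - g k z) sequentially"
      by (rule Weierstrass_m_test_ev) (simp add: summable_geometric)
    then have "uniform_limit (cball 0 R) (\<lambda>n z. g 0 z + (\<Sum>k<n. g (Suc k) z - g k z)) h sequentially"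
      unfolding h_def by (intro uniform_limit_add uniform_limit_const)
    then show ?thesis
      by (simp add: sum_lessThan_telescope[of "\<lambda>k. g k _"])
  qed
  have "entire_fun h"
    using g(1) lim unfolding P_def by (blast intro: entire_fun_uniform_limit)
  moreover have "cmod (h x - f x) < \<epsilon> x" if x: "x \<in> M" for x
  proof -
    have "(\<lambda>k. g k x) \<longlonglongrightarrow> h x"
      using tendsto_uniform_limitI[OF lim, of x "norm x"] by simp
    then have "(\<lambda>k. cmod (g k x - f x)) \<longlonglongrightarrow> cmod (h x - f x)"
      by (intro tendsto_intros)
    moreover have "\<forall>\<^sub>F k in sequentially. cmod (g k x - f x) \<le> \<epsilon> x / 2"
    proof (rule eventually_sequentiallyI)
      fix k
      assume "nat \<lceil>norm x\<rceil> \<le> k"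
      then have "norm x \<le> r (Suc (Suc k))"
        using r_ge[of "Suc (Suc k)"] by linarith
      then have "cmod (g k x - f x) < \<epsilon> x / 2 * (1 - (1/2) ^ Suc k)"
        using g(1)[of k] x unfolding P_def by simp
      also have "\<dots> \<le> \<epsilon> x / 2 * 1"
        using pos x by (intro mult_left_mono) (auto simp: less_imp_le)
      finally show "cmod (g k x - f x) \<le> \<epsilon> x / 2"
        by simp
    qed
    ultimately have "cmod (h x - f x) \<le> \<epsilon> x / 2"
      by (rule tendsto_upperbound) simp
    moreover have "\<epsilon> x / 2 < \<epsilon> x"
      using pos x by simp
    ultimately show ?thesis
      by linarith
  qed
  ultimately show "\<exists>g. entire_fun g \<and> (\<forall>x\<in>M. cmod (g x - f x) < \<epsilon> x)"
    by blast
qed (rule M)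

section \<open>Decoupling passes to products\<close>

definition vec_fst :: "complex ^ ('n::finite + 'm::finite) \<Rightarrow> complex ^ 'n" where
  "vec_fst z = (\<chi> i. z $ Inl i)"

definition vec_snd :: "complex ^ ('n::finite + 'm::finite) \<Rightarrow> complex ^ 'm" where
  "vec_snd z = (\<chi> j. z $ Inr j)"

lemma vec_fst_join [simp]: "vec_fst (vec_join (x, y)) = x"
  and vec_snd_join [simp]: "vec_snd (vec_join (x, y)) = y"
  by (simp_all add: vec_fst_def vec_snd_def vec_join_def vec_eq_iff)

lemma vec_join_fst_snd [simp]: "vec_join (vec_fst z, vec_snd z) = z"
  by (simp add: vec_fst_def vec_snd_def vec_join_def vec_eq_iff split: sum.split)

lemma linear_vec_fst: "linear vec_fst" and linear_vec_snd: "linear vec_snd"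
  by (auto intro!: linearI simp: vec_fst_def vec_snd_def vec_eq_iff)

lemma linear_vec_join: "linear vec_join"
  by (auto intro!: linearI simp: vec_join_def vec_eq_iff split: sum.split)

lemma vec_fst_scalar_mult: "vec_fst (c *s z) = c *s vec_fst z"
  and vec_snd_scalar_mult: "vec_snd (c *s z) = c *s vec_snd z"
  by (simp_all add: vec_fst_def vec_snd_def vec_eq_iff)

lemma continuous_on_vec_fst: "continuous_on S vec_fst"
  and continuous_on_vec_snd: "continuous_on S vec_snd"
  and continuous_on_vec_join: "continuous_on T vec_join"
  using linear_vec_fst linear_vec_snd linear_vec_join
  by (auto intro: linear_continuous_on simp: linear_conv_bounded_linear)

lemma vec_join_image_eq: "vec_join ` (A \<times> B) = {z. vec_fst z \<in> A \<and> vec_snd z \<in> B}"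
  by (force intro: image_eqI[of _ vec_join "(vec_fst z, vec_snd z)" for z])

lemma closed_vec_join_image:
  assumes "closed A" and "closed B"
  shows "closed (vec_join ` (A \<times> B))"
proof -
  have "vec_join ` (A \<times> B) = vec_fst -` A \<inter> vec_snd -` B"
    by (auto simp: vec_join_image_eq)
  then show ?thesis
    using assms by (auto intro!: closed_Int closed_vimage continuous_on_vec_fst continuous_on_vec_snd)
qed

lemma entire_fun_vec_fst: "entire_fun g \<Longrightarrow> entire_fun (\<lambda>z. g (vec_fst z))"
  and entire_fun_vec_snd: "entire_fun h \<Longrightarrow> entire_fun (\<lambda>z. h (vec_snd z))"
  by (auto intro: entire_fun_compose_linear linear_vec_fst linear_vec_snd
      simp: vec_fst_scalar_mult vec_snd_scalar_mult)

text \<open>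
  The factor \<open>h\<close> is chosen first and nothing is asked of it on \<open>K2\<close>; since \<open>L1\<close> does not depend on
  the tolerance, \<open>g\<close> can afterwards compensate for whatever size \<open>h\<close> has there.
\<close>

lemma decouples_tensor:
  fixes M1 K1 L1 :: "(complex ^ 'n) set" and M2 K2 :: "(complex ^ 'm) set"
  assumes dec1: "decouples M1 K1 L1" and dec2: "decouples M2 {} {}" and K2: "compact K2"
    and p: "continuous_on M1 p" "\<And>x. x \<in> M1 \<Longrightarrow> x \<in> L1 \<Longrightarrow> p x = 0" and q: "continuous_on M2 q"
    and X1: "compact X1" "X1 \<subseteq> M1" and X2: "compact X2" "X2 \<subseteq> M2" and \<delta>: "0 < \<delta>"
  obtains g h where "entire_fun g" and "entire_fun h"
    and "\<And>x y. x \<in> X1 \<Longrightarrow> y \<in> X2 \<Longrightarrow> cmod (g x * h y - p x * q y) < \<delta>"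
    and "\<And>x y. x \<in> K1 \<Longrightarrow> y \<in> K2 \<Longrightarrow> cmod (g x * h y) < \<delta>"
proof -
  have "bounded (p ` X1)"
    using p(1) X1 by (meson compact_continuous_image compact_imp_bounded continuous_on_subset)
  then obtain A where A: "0 < A" "\<And>x. x \<in> X1 \<Longrightarrow> cmod (p x) \<le> A"
    unfolding bounded_pos by blast
  have \<delta>A: "0 < \<delta> / (2 * A)"
    using A(1) \<delta> by simp
  obtain h where h: "entire_fun h" "\<And>y. y \<in> X2 \<Longrightarrow> cmod (h y - q y) < \<delta> / (2 * A)"
    by (rule decouplesE[OF dec2 q _ X2 \<delta>A]) auto
  obtain C where C: "0 \<le> C" "\<And>y. y \<in> X2 \<union> K2 \<Longrightarrow> cmod (h y) \<le> C"
    using entire_fun_bounded_on_compact[OF h(1) compact_Un[OF X2(1) K2]] by blast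
  have \<delta>C: "0 < \<delta> / (2 * (C + 1))"
    using C(1) \<delta> by simp
  obtain g where g: "entire_fun g"
    "\<And>x. x \<in> X1 \<Longrightarrow> cmod (g x - p x) < \<delta> / (2 * (C + 1))"
    "\<And>x. x \<in> K1 \<Longrightarrow> cmod (g x) < \<delta> / (2 * (C + 1))"
    by (rule decouplesE[OF dec1 p(1) _ X1 \<delta>C]) (use p(2) in auto)
  have small: "cmod (v * w) < \<delta> / 2" if "cmod v < \<delta> / (2 * (C + 1))" "cmod w \<le> C" for v w
  proof -
    have "cmod (v * w) \<le> cmod v * (C + 1)"
      unfolding norm_mult using that(2) by (intro mult_left_mono) auto
    also have "\<dots> < \<delta> / (2 * (C + 1)) * (C + 1)"
      using that(1) C(1) by (intro mult_strict_right_mono) auto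
    also have "\<dots> = \<delta> / 2"
      using C(1) by (simp add: field_simps)
    finally show ?thesis .
  qed
  show thesis
  proof (rule that[OF g(1) h(1)])
    fix x y
    assume x: "x \<in> X1" and y: "y \<in> X2"
    have "cmod (p x * (h y - q y)) \<le> A * cmod (h y - q y)"
      unfolding norm_mult using A(2)[OF x] by (intro mult_right_mono) auto
    also have "\<dots> < A * (\<delta> / (2 * A))"
      using h(2)[OF y] A(1) by (intro mult_strict_left_mono) auto
    also have "\<dots> = \<delta> / 2"
      using A(1) by simp
    finally have "cmod (p x * (h y - q y)) < \<delta> / 2" .
    moreover have "cmod ((g x - p x) * h y) < \<delta> / 2"
      using small[OF g(2)[OF x]] C(2) y by blast
    moreover have "g x * h y - p x * q y = (g x - p x) * h y + p x * (h y - q y)"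
      by (simp add: algebra_simps)
    ultimately show "cmod (g x * h y - p x * q y) < \<delta>"
      using norm_triangle_ineq[of "(g x - p x) * h y" "p x * (h y - q y)"] by simp
  next
    fix x y
    assume "x \<in> K1" and "y \<in> K2"
    then have "cmod (g x * h y) < \<delta> / 2"
      using small[OF g(3)] C(2) by blast
    then show "cmod (g x * h y) < \<delta>"
      using \<delta> by linarith
  qed
qed

text \<open>
  The weights are continuous on the whole space, not only on \<open>X\<close>: the tent functions are divided by
  their sum truncated from below, and on \<open>X\<close> the truncation has no effect.
\<close>

lemma compact_finite_partition_of_unity:
  fixes X :: "'a::metric_space set"
  assumes "compact X" and \<rho>: "0 < \<rho>"
  obtains F and \<phi> :: "'a \<Rightarrow> 'a \<Rightarrow> real" where "finite F" and "F \<subseteq> X"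
    and "\<And>c. continuous_on UNIV (\<phi> c)" and "\<And>c x. 0 \<le> \<phi> c x"
    and "\<And>c x. \<phi> c x \<noteq> 0 \<Longrightarrow> dist c x < \<rho>" and "\<And>x. x \<in> X \<Longrightarrow> (\<Sum>c\<in>F. \<phi> c x) = 1"
proof -
  obtain F where F: "finite F" "F \<subseteq> X" "X \<subseteq> (\<Union>c\<in>F. ball c (\<rho> / 2))"
    using seq_compact_imp_totally_bounded[OF compact_imp_seq_compact[OF assms(1)], rule_format,
        OF half_gt_zero[OF \<rho>]] by blast
  define \<tau> where "\<tau> c x = max 0 (\<rho> - dist c x)" for c x :: 'a
  define \<sigma> where "\<sigma> x = max (\<rho> / 2) (\<Sum>c\<in>F. \<tau> c x)" for x
  have \<sigma>: "0 < \<sigma> x" for x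
    using \<rho> unfolding \<sigma>_def by (simp add: less_max_iff_disj)
  have \<tau>_cont: "continuous_on UNIV (\<tau> c)" for c
    unfolding \<tau>_def by (intro continuous_intros)
  then have \<sigma>_cont: "continuous_on UNIV \<sigma>"
    unfolding \<sigma>_def by (intro continuous_intros)
  show thesis
  proof (rule that[of F "\<lambda>c x. \<tau> c x / \<sigma> x"])
    show "continuous_on UNIV (\<lambda>x. \<tau> c x / \<sigma> x)" for c
      using less_imp_neq[OF \<sigma>] by (intro continuous_on_divide \<tau>_cont \<sigma>_cont) metis
    show "0 \<le> \<tau> c x / \<sigma> x" for c x
      using \<sigma>[of x] unfolding \<tau>_def by simp
    show "dist c x < \<rho>" if "\<tau> c x / \<sigma> x \<noteq> 0" for c x
      using that unfolding \<tau>_def by (auto simp: max_def split: if_splits)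
    show "(\<Sum>c\<in>F. \<tau> c x / \<sigma> x) = 1" if x: "x \<in> X" for x
    proof -
      obtain c where c: "c \<in> F" "dist c x < \<rho> / 2"
        using F(3) x by auto
      have "\<rho> / 2 \<le> \<tau> c x"
        using c(2) unfolding \<tau>_def by linarith
      also have "\<dots> \<le> (\<Sum>c\<in>F. \<tau> c x)"
        by (rule member_le_sum[OF c(1) _ F(1)]) (simp add: \<tau>_def)
      finally have "(\<Sum>c\<in>F. \<tau> c x) = \<sigma> x"
        unfolding \<sigma>_def by simp
      then show ?thesis
        using \<sigma>[of x] by (simp flip: sum_divide_distrib)
    qed
  qed (use F in auto)
qed

text \<open>
  A partition of unity \<open>\<phi>\<close> in the first variable gives \<open>a(x, y) \<approx> \<Sum>c. \<phi> c x * a(s c, y)\<close>, where \<open>s c\<close> is a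
  sample point close to \<open>c\<close>. The sample is taken in \<open>L1\<close> whenever \<open>\<phi> c\<close> does not vanish on
  \<open>M1 \<inter> L1\<close>; then \<open>a(s c, \<cdot>)\<close> vanishes on \<open>M2 \<inter> L2\<close>. So in every summand one of the two factors
  satisfies the vanishing condition exactly, and each summand can be treated by itself.
\<close>

lemma decouples_product:
  fixes M1 K1 L1 :: "(complex ^ 'n) set" and M2 K2 L2 :: "(complex ^ 'm) set"
  assumes dec1: "decouples M1 K1 L1" "decouples M1 {} {}" and dec2: "decouples M2 K2 L2" "decouples M2 {} {}"
    and M1: "closed M1" and L1: "compact L1" and K: "compact K1" "compact K2"
  shows "decouples (vec_join ` (M1 \<times> M2)) (vec_join ` (K1 \<times> K2)) (vec_join ` (L1 \<times> L2))"
  unfolding decouples_def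
proof (intro allI impI)
  fix a :: "complex ^ ('n::finite + 'm::finite) \<Rightarrow> complex" and X and \<delta> :: real
  assume a: "continuous_on (vec_join ` (M1 \<times> M2)) a"
    and a0: "\<forall>z\<in>vec_join ` (M1 \<times> M2) \<inter> vec_join ` (L1 \<times> L2). a z = 0"
    and X: "compact X" "X \<subseteq> vec_join ` (M1 \<times> M2)" and \<delta>: "0 < \<delta>"
  define b where "b x y = a (vec_join (x, y))" for x y
  have b: "continuous_on (M1 \<times> M2) (\<lambda>w. b (fst w) (snd w))"
    unfolding b_def prod.collapse
    by (rule continuous_on_compose2[OF a continuous_on_vec_join]) auto
  have b0: "b x y = 0" if "x \<in> M1" "x \<in> L1" "y \<in> M2" "y \<in> L2" for x y
    using a0 that unfolding b_def by (auto simp: vec_join_image_eq)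
  define X1 where "X1 = vec_fst ` X"
  define X2 where "X2 = vec_snd ` X"
  have X1: "compact X1" "X1 \<subseteq> M1" and X2: "compact X2" "X2 \<subseteq> M2"
    unfolding X1_def X2_def using X
    by (auto simp: vec_join_image_eq intro!: compact_continuous_image continuous_on_vec_fst continuous_on_vec_snd)
  (* Sample points may lie in L1 outside X1, so uniform continuity is needed on this larger set. *)
  define Y1 where "Y1 = X1 \<union> (M1 \<inter> L1)"
  have Y1: "compact Y1" "Y1 \<subseteq> M1"
    unfolding Y1_def using X1 closed_Int_compact[OF M1 L1] by auto
  have "uniformly_continuous_on (Y1 \<times> X2) (\<lambda>w. b (fst w) (snd w))"
    using Y1 X2 by (intro compact_uniformly_continuous compact_Times continuous_on_subset[OF b]) auto
  from uniformly_continuous_onE[OF this half_gt_zero[OF \<delta>]]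
  obtain \<rho> where \<rho>: "0 < \<rho>" and "\<And>w w'. w \<in> Y1 \<times> X2 \<Longrightarrow> w' \<in> Y1 \<times> X2 \<Longrightarrow> dist w' w < \<rho> \<Longrightarrow>
      dist (b (fst w') (snd w')) (b (fst w) (snd w)) < \<delta> / 2"
    by metis
  from this(2)[of "(x, y)" "(x', y)" for x x' y]
  have unif: "cmod (b x' y - b x y) < \<delta> / 2"
    if "x \<in> Y1" "x' \<in> Y1" "y \<in> X2" "dist x' x < \<rho>" for x x' y
    using that by (auto simp: dist_Pair_Pair dist_norm)
  obtain F and \<phi> :: "complex ^ 'n \<Rightarrow> complex ^ 'n \<Rightarrow> real" where F: "finite F" "F \<subseteq> X1"
    and \<phi>: "\<And>c. continuous_on UNIV (\<phi> c)" "\<And>c x. 0 \<le> \<phi> c x"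
      "\<And>c x. \<phi> c x \<noteq> 0 \<Longrightarrow> dist c x < \<rho> / 2" "\<And>x. x \<in> X1 \<Longrightarrow> (\<Sum>c\<in>F. \<phi> c x) = 1"
    using compact_finite_partition_of_unity[OF X1(1) half_gt_zero[OF \<rho>]] by blast
  define s where "s c = (if \<exists>x\<in>M1 \<inter> L1. \<phi> c x \<noteq> 0 then SOME x. x \<in> M1 \<inter> L1 \<and> \<phi> c x \<noteq> 0 else c)" for c
  have s: "s c \<in> M1 \<inter> L1 \<and> \<phi> c (s c) \<noteq> 0" if "\<exists>x\<in>M1 \<inter> L1. \<phi> c x \<noteq> 0" for c
    using someI_ex[of "\<lambda>x. x \<in> M1 \<inter> L1 \<and> \<phi> c x \<noteq> 0"] that unfolding s_def by auto
  have s_else: "s c = c" if "\<not> (\<exists>x\<in>M1 \<inter> L1. \<phi> c x \<noteq> 0)" for c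
    using that unfolding s_def by (rule if_not_P)
  have s_Y1: "s c \<in> Y1" if "c \<in> F" for c
    using s[of c] s_else[of c] that F(2) unfolding Y1_def by (metis IntE UnI1 UnI2 subsetD)
  have s_near: "dist (s c) x < \<rho>" if "\<phi> c x \<noteq> 0" for c x
  proof -
    have "dist c (s c) < \<rho> / 2"
      using \<phi>(3)[of c "s c"] s[of c] s_else[of c] \<rho> by (cases "\<exists>x\<in>M1 \<inter> L1. \<phi> c x \<noteq> 0") auto
    then show ?thesis
      using \<phi>(3)[OF that] dist_triangle3[of "s c" x c] by simp
  qed
  define \<eta> where "\<eta> = \<delta> / (2 * (real (card F) + 1))"
  have \<eta>: "0 < \<eta>"
    unfolding \<eta>_def using \<delta> by simp
  have \<eta>_sum: "real (card F) * \<eta> < \<delta> / 2"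
    unfolding \<eta>_def using \<delta> by (simp add: field_simps)
  have "\<exists>G. entire_fun G \<and> (\<forall>x\<in>X1. \<forall>y\<in>X2. cmod (G (vec_join (x, y)) - \<phi> c x * b (s c) y) < \<eta>) \<and>
      (\<forall>x\<in>K1. \<forall>y\<in>K2. cmod (G (vec_join (x, y))) < \<eta>)" if c: "c \<in> F" for c
  proof -
    have p: "continuous_on M1 (\<lambda>x. of_real (\<phi> c x) :: complex)"
      by (intro continuous_intros continuous_on_subset[OF \<phi>(1)]) auto
    have q: "continuous_on M2 (b (s c))"
      using s_Y1[OF c] Y1(2) by (intro continuous_on_compose2[OF b, of _ "\<lambda>y. (s c, y)", simplified]
          continuous_intros) auto
    show ?thesis
    proof (cases "\<exists>x\<in>M1 \<inter> L1. \<phi> c x \<noteq> 0")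
      case True
      then have q0: "b (s c) y = 0" if "y \<in> M2" "y \<in> L2" for y
        using b0 s that by blast
      obtain h g where "entire_fun h" "entire_fun g"
        "\<And>y x. y \<in> X2 \<Longrightarrow> x \<in> X1 \<Longrightarrow> cmod (h y * g x - b (s c) y * \<phi> c x) < \<eta>"
        "\<And>y x. y \<in> K2 \<Longrightarrow> x \<in> K1 \<Longrightarrow> cmod (h y * g x) < \<eta>"
        using decouples_tensor[OF dec2(1) dec1(2) K(1) q q0 p X2 X1 \<eta>] by auto
      then show ?thesis
        by (intro exI[of _ "\<lambda>z. h (vec_snd z) * g (vec_fst z)"])
          (auto intro!: entire_fun_mult entire_fun_vec_fst entire_fun_vec_snd simp: mult.commute)
    next
      case False
      then have p0: "of_real (\<phi> c x) = (0 :: complex)" if "x \<in> M1" "x \<in> L1" for x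
        using that by auto
      obtain g h where "entire_fun g" "entire_fun h"
        "\<And>x y. x \<in> X1 \<Longrightarrow> y \<in> X2 \<Longrightarrow> cmod (g x * h y - \<phi> c x * b (s c) y) < \<eta>"
        "\<And>x y. x \<in> K1 \<Longrightarrow> y \<in> K2 \<Longrightarrow> cmod (g x * h y) < \<eta>"
        using decouples_tensor[OF dec1(1) dec2(2) K(2) p p0 q X1 X2 \<eta>] by auto
      then show ?thesis
        by (intro exI[of _ "\<lambda>z. g (vec_fst z) * h (vec_snd z)"])
          (auto intro!: entire_fun_mult entire_fun_vec_fst entire_fun_vec_snd)
    qed
  qed
  then obtain G where G: "\<And>c. c \<in> F \<Longrightarrow> entire_fun (G c)"
    "\<And>c x y. c \<in> F \<Longrightarrow> x \<in> X1 \<Longrightarrow> y \<in> X2 \<Longrightarrow> cmod (G c (vec_join (x, y)) - \<phi> c x * b (s c) y) < \<eta>"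
    "\<And>c x y. c \<in> F \<Longrightarrow> x \<in> K1 \<Longrightarrow> y \<in> K2 \<Longrightarrow> cmod (G c (vec_join (x, y))) < \<eta>"
    by metis
  have sum_small: "cmod (\<Sum>c\<in>F. v c) < \<delta> / 2" if "\<And>c. c \<in> F \<Longrightarrow> cmod (v c) < \<eta>" for v
    using sum_norm_le[of F v "\<lambda>_. \<eta>"] that \<eta>_sum by (force simp: less_imp_le)
  show "\<exists>g. entire_fun g \<and> (\<forall>z\<in>X. cmod (g z - a z) < \<delta>) \<and>
      (\<forall>z\<in>vec_join ` (K1 \<times> K2). cmod (g z) < \<delta>)"
  proof (intro exI[of _ "\<lambda>z. \<Sum>c\<in>F. G c z"] conjI ballI)
    show "entire_fun (\<lambda>z. \<Sum>c\<in>F. G c z)"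
      by (rule entire_fun_sum[OF G(1)])
  next
    fix z
    assume "z \<in> vec_join ` (K1 \<times> K2)"
    then obtain x y where "z = vec_join (x, y)" "x \<in> K1" "y \<in> K2"
      by blast
    then have "cmod (\<Sum>c\<in>F. G c z) < \<delta> / 2"
      using sum_small[of "\<lambda>c. G c z"] G(3) by blast
    then show "cmod (\<Sum>c\<in>F. G c z) < \<delta>"
      using \<delta> by linarith
  next
    fix z
    assume z: "z \<in> X"
    define x where "x = vec_fst z"
    define y where "y = vec_snd z"
    have xy: "x \<in> X1" "y \<in> X2" "vec_join (x, y) = z" "a z = b x y"
      unfolding x_def y_def X1_def X2_def b_def using z by auto
    have "(\<Sum>c\<in>F. of_real (\<phi> c x)) = (1 :: complex)"
      using \<phi>(4)[OF xy(1)] by (metis of_real_1 of_real_sum)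
    then have "(\<Sum>c\<in>F. of_real (\<phi> c x) * (b (s c) y - b x y)) = (\<Sum>c\<in>F. of_real (\<phi> c x) * b (s c) y) - b x y"
      by (simp add: right_diff_distrib sum_subtractf flip: sum_distrib_right)
    then have split: "(\<Sum>c\<in>F. G c z) - a z =
        (\<Sum>c\<in>F. G c z - of_real (\<phi> c x) * b (s c) y) + (\<Sum>c\<in>F. of_real (\<phi> c x) * (b (s c) y - b x y))"
      unfolding xy(4) by (simp add: sum_subtractf)
    have "cmod (\<Sum>c\<in>F. of_real (\<phi> c x) * (b (s c) y - b x y)) \<le> (\<Sum>c\<in>F. \<phi> c x * (\<delta> / 2))"
    proof (rule sum_norm_le)
      fix c
      assume c: "c \<in> F"
      show "cmod (of_real (\<phi> c x) * (b (s c) y - b x y)) \<le> \<phi> c x * (\<delta> / 2)"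
      proof (cases "\<phi> c x = 0")
        case False
        have "x \<in> Y1"
          using xy(1) unfolding Y1_def by blast
        from unif[OF this s_Y1[OF c] xy(2) s_near[OF False]]
        have "cmod (b (s c) y - b x y) \<le> \<delta> / 2"
          by (rule less_imp_le)
        then show ?thesis
          unfolding norm_mult norm_of_real abs_of_nonneg[OF \<phi>(2)]
          by (rule mult_left_mono[OF _ \<phi>(2)])
      qed simp
    qed
    also have "\<dots> = \<delta> / 2"
      using \<phi>(4)[OF xy(1)] by (simp flip: sum_distrib_right sum_divide_distrib)
    finally have "cmod (\<Sum>c\<in>F. of_real (\<phi> c x) * (b (s c) y - b x y)) \<le> \<delta> / 2" .
    moreover have "cmod (\<Sum>c\<in>F. G c z - of_real (\<phi> c x) * b (s c) y) < \<delta> / 2"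
      by (rule sum_small) (use G(2)[OF _ xy(1,2)] in \<open>simp add: xy(3)\<close>)
    ultimately show "cmod ((\<Sum>c\<in>F. G c z) - a z) < \<delta>"
      unfolding split
      using norm_triangle_ineq[of "\<Sum>c\<in>F. G c z - of_real (\<phi> c x) * b (s c) y"
          "\<Sum>c\<in>F. of_real (\<phi> c x) * (b (s c) y - b x y)"] by linarith
  qed
qed

section \<open>Products of sets with Carleman approximation\<close>

theorem theorem1p3:
  fixes M1 :: "(complex ^ 'n1) set" and M2 :: "(complex ^ 'n2) set"
  assumes "stratified_totally_real_set M1" and "stratified_totally_real_set M2"
    and "admits_Carleman_approximation M1" and "admits_Carleman_approximation M2"
  shows "admits_Carleman_approximation (vec_join ` (M1 \<times> M2))"
proof (rule decouples_imp_Carleman)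
  have M: "closed M1" "closed M2"
    using assms(3,4) unfolding admits_Carleman_approximation_def by auto
  note dec0 = Carleman_imp_decouples_empty[OF assms(3)] Carleman_imp_decouples_empty[OF assms(4)]
  show "closed (vec_join ` (M1 \<times> M2))"
    by (rule closed_vec_join_image[OF M])
  show "decouples (vec_join ` (M1 \<times> M2)) {} {}"
    using decouples_product[OF dec0(1,1,2,2) M(1)] by simp
  fix R :: real
  define K1 :: "(complex ^ 'n1) set" where "K1 = vec_fst ` (cball 0 R :: (complex ^ ('n1 + 'n2)) set)"
  define K2 :: "(complex ^ 'n2) set" where "K2 = vec_snd ` (cball 0 R :: (complex ^ ('n1 + 'n2)) set)"
  have K: "compact K1" "compact K2"
    unfolding K1_def K2_def
    by (auto intro!: compact_continuous_image continuous_on_vec_fst continuous_on_vec_snd)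
  obtain R1 R2 where R: "decouples M1 K1 (cball 0 R1)" "decouples M2 K2 (cball 0 R2)"
    using Carleman_imp_decouples[OF assms(3) K(1)] Carleman_imp_decouples[OF assms(4) K(2)] by blast
  have "compact (vec_join ` (cball 0 R1 \<times> cball 0 R2 :: ((complex ^ 'n1) \<times> (complex ^ 'n2)) set))"
    by (intro compact_continuous_image continuous_on_vec_join compact_Times compact_cball)
  then have "bounded (vec_join ` (cball 0 R1 \<times> cball 0 R2 :: ((complex ^ 'n1) \<times> (complex ^ 'n2)) set))"
    by (rule compact_imp_bounded)
  then obtain S where S: "vec_join ` (cball 0 R1 \<times> cball 0 R2 :: ((complex ^ 'n1) \<times> (complex ^ 'n2)) set) \<subseteq> cball 0 S"
    unfolding bounded_iff subset_iff mem_cball_0 by blast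
  have "cball 0 R \<subseteq> vec_join ` (K1 \<times> K2)"
    unfolding vec_join_image_eq K1_def K2_def by blast
  from decouples_mono[OF decouples_product[OF R(1) dec0(1) R(2) dec0(2) M(1) compact_cball K] this S]
  show "\<exists>S. decouples (vec_join ` (M1 \<times> M2)) (cball 0 R) (cball 0 S)" ..
qed

end
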